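(* Let $a\in\mathbb{U}$ and let $h$ be a complex-valued harmonic map from the unit disk $\mathbb{U}$ into itself with $h(0)=a$. Then $$|h(z)|\le X^+(|z|,|a|)\qquad\text{for all } z\in\mathbb{U}.$$
   Context: $\mathbb{U}$ is the open unit disk in $\mathbb{C}$. For $t\in(-1,1)$ and $0\le r<1$, $X^+(r,t)=\frac4\pi\arctan\Big(\tan\big(\tfrac{\pi}{4}(t+1)\big)\,\frac{1+r}{1-r}\Big)-1$. *)

theory Defs
  imports "HOL-Analysis.Analysis"
begin

text \<open>
  A function on a subset of the plane has partial derivatives \<open>fx\<close> and \<open>fy\<close>
  (with respect to $x = \mathrm{Re}\,z$ and $y = \mathrm{Im}\,z$); differentiability is meant in the
  real (Frechet) sense.
\<close>

definition has_partials_on ::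
    "(complex \<Rightarrow> 'a::real_normed_vector) \<Rightarrow> (complex \<Rightarrow> 'a) \<Rightarrow> (complex \<Rightarrow> 'a) \<Rightarrow> complex set \<Rightarrow> bool" where
  "has_partials_on f fx fy S \<longleftrightarrow>
     (\<forall>z\<in>S. (f has_derivative (\<lambda>w. Re w *\<^sub>R fx z + Im w *\<^sub>R fy z)) (at z))"

text \<open>
  Harmonic: twice continuously differentiable on an open set, with vanishing Laplacian.
  The functions \<open>fxx\<close>, \<open>fxy\<close> are the partial derivatives of \<open>fx\<close>, and \<open>fyx\<close>, \<open>fyy\<close> those of \<open>fy\<close>.
\<close>

definition harmonic_on :: "(complex \<Rightarrow> 'a::real_normed_vector) \<Rightarrow> complex set \<Rightarrow> bool" where
  "harmonic_on f S \<longleftrightarrow> open S \<and>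
     (\<exists>fx fy fxx fxy fyx fyy.
        has_partials_on f fx fy S \<and>
        has_partials_on fx fxx fxy S \<and>
        has_partials_on fy fyx fyy S \<and>
        continuous_on S fxx \<and> continuous_on S fxy \<and>
        continuous_on S fyx \<and> continuous_on S fyy \<and>
        (\<forall>z\<in>S. fxx z + fyy z = 0))"

text \<open>Only meaningful for \<open>0 \<le> r < 1\<close> and \<open>-1 < t < 1\<close>.\<close>

definition X_plus :: "real \<Rightarrow> real \<Rightarrow> real" where
  "X_plus r t = 4 / pi * arctan (tan (pi / 4 * (t + 1)) * ((1 + r) / (1 - r))) - 1"

end

theory Submission
  imports Defs "HOL-Complex_Analysis.Conformal_Mappings"
begin

text \<open>
  Rotating \<open>h\<close> by a unimodular constant makes \<open>h z\<close> real and nonnegative at a prescribed point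
  \<open>z\<close>, so it is enough to bound \<open>u = Re (c * h)\<close>, a real harmonic function with values in
  \<open>(-1, 1)\<close>; note that \<open>u 0 \<le> cmod a\<close> and that \<open>X_plus r\<close> is increasing.

  On the disk \<open>u\<close> is the real part of a holomorphic \<open>F\<close>: the symmetry of the second derivative
  (lemma \<open>second_derivative_symmetric\<close>) and the vanishing of the Laplacian are the Cauchy-Riemann
  equations for \<open>u\<^sub>x - \<i> u\<^sub>y\<close>, and \<open>F\<close> is a primitive of it (lemma \<open>harmonic_on_eq_Re_holomorphic\<close>).

  Now \<open>F\<close> maps into the strip \<open>\<bar>Re w\<bar> < 1\<close>. The Schwarz lemma, applied after a conformal map of
  that strip onto the disk sending \<open>F 0\<close> to \<open>0\<close>, confines \<open>F z\<close> to a hyperbolic disk about \<open>F 0\<close>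
  (lemma \<open>Schwarz_Pick_strip\<close>). The largest real part on a hyperbolic disk is attained on the
  horizontal line through its centre; in the coordinate \<open>tan (pi / 4 * (t + 1))\<close> on that line the
  disk of pseudo-hyperbolic radius \<open>r\<close> is an interval whose right end is \<open>(1 + r) / (1 - r)\<close>
  times the coordinate of the centre (lemma \<open>tan_le_of_sin_diff_le\<close>).
\<close>

section \<open>Symmetry of the second derivative\<close>

text \<open>
  The second difference on the left is symmetric in \<open>v\<close> and \<open>w\<close> while the limit treats them
  differently, which is what makes the next lemma work. The limit is found by applying the mean
  value theorem to \<open>\<lambda>s. f (p + s v + t w) - f (p + s v)\<close>, whose derivative is a first difference of
  \<open>\<lambda>x. f' x v\<close>.
\<close>

lemma second_difference_tendsto:
  fixes f :: "'a::real_normed_vector \<Rightarrow> real"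
  assumes "open S" "p \<in> S"
    and f: "\<And>x. x \<in> S \<Longrightarrow> (f has_derivative f' x) (at x)"
    and f'v: "((\<lambda>x. f' x v) has_derivative L) (at p)"
  shows "((\<lambda>t. (f (p + t *\<^sub>R v + t *\<^sub>R w) - f (p + t *\<^sub>R v) - f (p + t *\<^sub>R w) + f p) / t\<^sup>2)
            \<longlongrightarrow> L w) (at_right 0)"
proof (rule tendstoI)
  fix e :: real assume "e > 0"
  define M where "M = 2 * norm v + norm w + 1"
  have M: "M > 0" unfolding M_def by (smt (verit) norm_ge_zero)
  define e' where "e' = e / (2 * M)"
  have e': "e' > 0" using \<open>e > 0\<close> M by (simp add: e'_def)
  interpret L: bounded_linear L using f'v by (rule has_derivative_bounded_linear)
  obtain d1 where d1: "d1 > 0"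
    and L_approx: "\<And>y. norm (y - p) < d1 \<Longrightarrow>
          norm (f' y v - f' p v - L (y - p)) \<le> e' * norm (y - p)"
    using f'v e' unfolding has_derivative_at_alt by blast
  obtain d2 where d2: "d2 > 0" "ball p d2 \<subseteq> S"
    using \<open>open S\<close> \<open>p \<in> S\<close> by (meson open_contains_ball)
  define d where "d = min d1 d2 / M"
  have "d > 0" using d1 d2 M by (simp add: d_def)
  have close: "norm (s *\<^sub>R v + \<tau> *\<^sub>R w) < min d1 d2" "norm (s *\<^sub>R v + \<tau> *\<^sub>R w) \<le> t * (norm v + norm w)"
    if "0 \<le> s" "s \<le> t" "0 \<le> \<tau>" "\<tau> \<le> t" "0 < t" "t < d" for s \<tau> t
  proof -
    have "norm (s *\<^sub>R v + \<tau> *\<^sub>R w) \<le> s * norm v + \<tau> * norm w"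
      using that by (metis abs_of_nonneg norm_scaleR norm_triangle_ineq)
    also have "\<dots> \<le> t * norm v + t * norm w"
      using that by (intro add_mono mult_right_mono) auto
    finally show *: "norm (s *\<^sub>R v + \<tau> *\<^sub>R w) \<le> t * (norm v + norm w)"
      by (simp add: algebra_simps)
    also have "\<dots> \<le> t * M"
      using that by (intro mult_left_mono) (auto simp: M_def)
    also have "\<dots> < min d1 d2"
      using that M by (simp add: d_def field_simps)
    finally show "norm (s *\<^sub>R v + \<tau> *\<^sub>R w) < min d1 d2" .
  qed
  have est: "dist ((f (p + t *\<^sub>R v + t *\<^sub>R w) - f (p + t *\<^sub>R v) - f (p + t *\<^sub>R w) + f p) / t\<^sup>2) (L w) < e"
    if t: "0 < t" "t < d" for t
  proof -
    define \<phi> where "\<phi> s = f (p + s *\<^sub>R v + t *\<^sub>R w) - f (p + s *\<^sub>R v)" for s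
    have in_S: "p + s *\<^sub>R v + \<tau> *\<^sub>R w \<in> S" if "0 \<le> s" "s \<le> t" "0 \<le> \<tau>" "\<tau> \<le> t" for s \<tau>
    proof -
      have "dist p (p + s *\<^sub>R v + \<tau> *\<^sub>R w) = norm (s *\<^sub>R v + \<tau> *\<^sub>R w)"
        by (metis add.assoc add_diff_cancel_left' dist_commute dist_norm)
      then show ?thesis
        using close(1)[of s t \<tau>] that t d2(2) by (auto simp: subset_iff)
    qed
    have line: "((\<lambda>s. f (p + s *\<^sub>R v + \<tau> *\<^sub>R w)) has_real_derivative f' (p + s *\<^sub>R v + \<tau> *\<^sub>R w) v) (at s)"
      if "0 \<le> s" "s \<le> t" "0 \<le> \<tau>" "\<tau> \<le> t" for s \<tau>
    proof -
      note F = f[OF in_S[OF that]]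
      have "((\<lambda>s. f (p + s *\<^sub>R v + \<tau> *\<^sub>R w)) has_derivative (\<lambda>h. f' (p + s *\<^sub>R v + \<tau> *\<^sub>R w) (h *\<^sub>R v))) (at s)"
        by (rule has_derivative_compose[where f = "\<lambda>s. p + s *\<^sub>R v + \<tau> *\<^sub>R w", OF _ F]) (auto intro!: derivative_eq_intros)
      moreover have "(\<lambda>h. f' (p + s *\<^sub>R v + \<tau> *\<^sub>R w) (h *\<^sub>R v)) = (*) (f' (p + s *\<^sub>R v + \<tau> *\<^sub>R w) v)"
        by (simp add: fun_eq_iff linear_cmul[OF has_derivative_linear[OF F]])
      ultimately show ?thesis
        by (simp only: has_field_derivative_def)
    qed
    have "\<exists>s. 0 < s \<and> s < t \<and>
        \<phi> t - \<phi> 0 = (t - 0) * (f' (p + s *\<^sub>R v + t *\<^sub>R w) v - f' (p + s *\<^sub>R v) v)"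
    proof (rule MVT2)
      fix s assume "0 \<le> s" "s \<le> t"
      then show "(\<phi> has_real_derivative
          f' (p + s *\<^sub>R v + t *\<^sub>R w) v - f' (p + s *\<^sub>R v) v) (at s)"
        unfolding \<phi>_def using line[of s t] line[of s 0] t by (auto intro!: derivative_intros)
    qed (use t in auto)
    then obtain s where s: "0 < s" "s < t"
      and mvt: "\<phi> t - \<phi> 0 = t * (f' (p + s *\<^sub>R v + t *\<^sub>R w) v - f' (p + s *\<^sub>R v) v)"
      by auto
    have A: "\<bar>f' (p + s *\<^sub>R v + \<tau> *\<^sub>R w) v - f' p v - (s * L v + \<tau> * L w)\<bar>
               \<le> e' * norm (s *\<^sub>R v + \<tau> *\<^sub>R w)" if "0 \<le> \<tau>" "\<tau> \<le> t" for \<tau>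
      using L_approx[of "p + s *\<^sub>R v + \<tau> *\<^sub>R w"] close(1)[of s t \<tau>] that t s
      by (simp add: L.add L.scaleR add.assoc)
    have "\<bar>(f' (p + s *\<^sub>R v + t *\<^sub>R w) v - f' (p + s *\<^sub>R v) v) - t * L w\<bar>
            \<le> e' * norm (s *\<^sub>R v + t *\<^sub>R w) + e' * norm (s *\<^sub>R v)"
      using A[of t] A[of 0] t by (simp add: abs_le_iff)
    also have "\<dots> \<le> e' * (t * (norm v + norm w)) + e' * (t * norm v)"
      using close(2)[of s t t] s t e' by (intro add_mono mult_left_mono) (auto intro: mult_right_mono)
    also have "\<dots> \<le> e' * (t * M)"
      using e' t by (simp add: M_def algebra_simps)
    also have "\<dots> = t * (e / 2)"
      using M by (simp add: e'_def)
    finally have B: "\<bar>(f' (p + s *\<^sub>R v + t *\<^sub>R w) v - f' (p + s *\<^sub>R v) v) - t * L w\<bar> \<le> t * (e / 2)" .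
    define Q where "Q = f' (p + s *\<^sub>R v + t *\<^sub>R w) v - f' (p + s *\<^sub>R v) v"
    have "(f (p + t *\<^sub>R v + t *\<^sub>R w) - f (p + t *\<^sub>R v) - f (p + t *\<^sub>R w) + f p) = t * Q"
      using mvt by (simp add: \<phi>_def Q_def)
    then have "dist ((f (p + t *\<^sub>R v + t *\<^sub>R w) - f (p + t *\<^sub>R v) - f (p + t *\<^sub>R w) + f p) / t\<^sup>2) (L w)
                 = \<bar>(Q - t * L w) / t\<bar>"
      using t by (simp add: dist_real_def power2_eq_square diff_divide_distrib)
    also have "\<dots> = \<bar>Q - t * L w\<bar> / t"
      using t by simp
    also have "\<dots> \<le> e / 2"
      using B t by (simp add: Q_def field_simps)
    finally show ?thesis using \<open>e > 0\<close> by linarith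
  qed
  show "\<forall>\<^sub>F t in at_right 0. dist ((f (p + t *\<^sub>R v + t *\<^sub>R w) - f (p + t *\<^sub>R v) - f (p + t *\<^sub>R w) + f p) / t\<^sup>2) (L w) < e"
    unfolding eventually_at_right_field using est \<open>d > 0\<close> by blast
qed

lemma second_derivative_symmetric:
  fixes f :: "'a::real_normed_vector \<Rightarrow> real"
  assumes "open S" "p \<in> S"
    and "\<And>x. x \<in> S \<Longrightarrow> (f has_derivative f' x) (at x)"
    and "((\<lambda>x. f' x v) has_derivative L) (at p)"
    and "((\<lambda>x. f' x w) has_derivative K) (at p)"
  shows "L w = K v"
proof (rule tendsto_unique[OF trivial_limit_at_right_real])
  show "((\<lambda>t. (f (p + t *\<^sub>R v + t *\<^sub>R w) - f (p + t *\<^sub>R v) - f (p + t *\<^sub>R w) + f p) / t\<^sup>2)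
          \<longlongrightarrow> L w) (at_right 0)"
    using assms by (intro second_difference_tendsto)
  show "((\<lambda>t. (f (p + t *\<^sub>R v + t *\<^sub>R w) - f (p + t *\<^sub>R v) - f (p + t *\<^sub>R w) + f p) / t\<^sup>2)
          \<longlongrightarrow> K v) (at_right 0)"
    using second_difference_tendsto[OF assms(1-3,5), of v] by (simp add: algebra_simps)
qed

section \<open>Harmonic functions as real parts of holomorphic functions\<close>

lemma has_partials_on_bounded_linear:
  assumes "bounded_linear T" "has_partials_on f fx fy S"
  shows "has_partials_on (\<lambda>z. T (f z)) (\<lambda>z. T (fx z)) (\<lambda>z. T (fy z)) S"
proof -
  interpret T: bounded_linear T by fact
  show ?thesis
    using assms(2) unfolding has_partials_on_def
    by (auto dest!: bspec T.has_derivative simp: T.add T.scaleR)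
qed

lemma harmonic_on_bounded_linear:
  assumes "bounded_linear T" "harmonic_on f S"
  shows "harmonic_on (\<lambda>z. T (f z)) S"
proof -
  interpret T: bounded_linear T by fact
  obtain fx fy fxx fxy fyx fyy where *: "open S"
    "has_partials_on f fx fy S" "has_partials_on fx fxx fxy S" "has_partials_on fy fyx fyy S"
    "continuous_on S fxx" "continuous_on S fxy" "continuous_on S fyx" "continuous_on S fyy"
    and laplace: "\<forall>z\<in>S. fxx z + fyy z = 0"
    using assms(2) unfolding harmonic_on_def by blast
  have "\<forall>z\<in>S. T (fxx z) + T (fyy z) = 0"
    using laplace by (metis T.add T.zero)
  then show ?thesis
    unfolding harmonic_on_def
    using *(1) has_partials_on_bounded_linear[OF assms(1) *(2)]
      has_partials_on_bounded_linear[OF assms(1) *(3)]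
      has_partials_on_bounded_linear[OF assms(1) *(4)]
      T.continuous_on[OF *(5)] T.continuous_on[OF *(6)] T.continuous_on[OF *(7)]
      T.continuous_on[OF *(8)]
    by blast
qed

text \<open>
  The function \<open>g = u\<^sub>x - \<i> u\<^sub>y\<close> is holomorphic: of its Cauchy-Riemann equations one is the Laplace
  equation, the other is \<open>u\<^sub>x\<^sub>y = u\<^sub>y\<^sub>x\<close>. The real part of a primitive of \<open>g\<close> has the same gradient
  as \<open>u\<close>, hence differs from \<open>u\<close> by a constant.
\<close>

lemma harmonic_on_eq_Re_holomorphic:
  fixes u :: "complex \<Rightarrow> real"
  assumes "harmonic_on u S" "convex S"
  obtains F where "F holomorphic_on S" "\<And>z. z \<in> S \<Longrightarrow> u z = Re (F z)"
proof -
  obtain ux uy uxx uxy uyx uyy where "open S"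
    and u: "\<And>z. z \<in> S \<Longrightarrow> (u has_derivative (\<lambda>w. Re w *\<^sub>R ux z + Im w *\<^sub>R uy z)) (at z)"
    and ux: "\<And>z. z \<in> S \<Longrightarrow> (ux has_derivative (\<lambda>w. Re w *\<^sub>R uxx z + Im w *\<^sub>R uxy z)) (at z)"
    and uy: "\<And>z. z \<in> S \<Longrightarrow> (uy has_derivative (\<lambda>w. Re w *\<^sub>R uyx z + Im w *\<^sub>R uyy z)) (at z)"
    and laplace: "\<And>z. z \<in> S \<Longrightarrow> uxx z + uyy z = 0"
    using assms(1) unfolding harmonic_on_def has_partials_on_def by blast
  have mixed: "uxy z = uyx z" if "z \<in> S" for z
    using second_derivative_symmetric[OF \<open>open S\<close> that u, where v = 1 and w = \<i>,
        where L = "\<lambda>w. Re w *\<^sub>R uxx z + Im w *\<^sub>R uxy z" and K = "\<lambda>w. Re w *\<^sub>R uyx z + Im w *\<^sub>R uyy z"]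
      ux[OF that] uy[OF that]
    by simp
  define g where "g z = complex_of_real (ux z) - \<i> * complex_of_real (uy z)" for z
  have "(g has_field_derivative (of_real (uxx z) - \<i> * of_real (uyx z))) (at z)" if "z \<in> S" for z
    unfolding has_field_derivative_def g_def
    using laplace[OF that, THEN eq_neg_iff_add_eq_0[THEN iffD2]] mixed[OF that]
    by (auto intro!: derivative_eq_intros ux uy that simp: fun_eq_iff complex_eq_iff algebra_simps)
  then have "g holomorphic_on S"
    using \<open>open S\<close> by (auto simp: holomorphic_on_open)
  then obtain G where G: "\<And>z. z \<in> S \<Longrightarrow> (G has_field_derivative g z) (at z within S)"
    using holomorphic_convex_primitive'[OF assms(2) \<open>open S\<close>] by metis
  have "((\<lambda>z. u z - Re (G z)) has_derivative (\<lambda>w. 0)) (at z within S)" if "z \<in> S" for z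
  proof -
    have "((\<lambda>z. u z - Re (G z)) has_derivative
            (\<lambda>w. (Re w *\<^sub>R ux z + Im w *\<^sub>R uy z) - Re (g z * w))) (at z within S)"
      using G[OF that] has_derivative_at_withinI[OF u[OF that]] unfolding has_field_derivative_def
      by (intro derivative_intros)
    then show ?thesis by (simp add: g_def algebra_simps)
  qed
  then have "\<exists>c. \<forall>z\<in>S. u z - Re (G z) = c"
    by (rule has_derivative_zero_constant[OF assms(2)])
  then obtain c where c: "\<And>z. z \<in> S \<Longrightarrow> u z - Re (G z) = c"
    by blast
  show thesis
  proof
    show "(\<lambda>z. G z + of_real c) holomorphic_on S"
      using G by (intro holomorphic_intros) (auto simp: holomorphic_on_def field_differentiable_def)
    show "u z = Re (G z + of_real c)" if "z \<in> S" for z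
      using c[OF that] by simp
  qed
qed

section \<open>The Schwarz-Pick inequality for a strip\<close>

text \<open>
  The imaginary part enters \<open>(cmod (sin \<zeta>))\<^sup>2 = (sin (Re \<zeta>))\<^sup>2 + (sinh (Im \<zeta>))\<^sup>2\<close> as a separate
  summand, so ratios of sines with equal imaginary parts can be compared through their real parts.
\<close>

lemma cmod_sin_squared_diff:
  assumes "Im \<xi> = Im \<zeta>"
  shows "(cmod (sin \<zeta>))\<^sup>2 - (cmod (sin \<xi>))\<^sup>2 = (sin (Re \<zeta>))\<^sup>2 - (sin (Re \<xi>))\<^sup>2"
  unfolding norm_sin_squared assms cos_double_sin by (simp add: field_simps)

lemma sin_squared_le_cmod_sin_squared: "(sin (Re \<zeta>))\<^sup>2 \<le> (cmod (sin \<zeta>))\<^sup>2"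
proof -
  have "(cmod (sin \<zeta>))\<^sup>2 - (cmod (sin (\<i> * of_real (Im \<zeta>))))\<^sup>2 = (sin (Re \<zeta>))\<^sup>2"
    using cmod_sin_squared_diff[of "\<i> * of_real (Im \<zeta>)" \<zeta>] by simp
  then show ?thesis
    by (metis diff_ge_0_iff_ge diff_diff_eq2 add_diff_cancel_left' zero_le_power2)
qed

text \<open>
  For \<open>\<omega>\<close> in the strip \<open>0 < Re \<omega> < pi / 2\<close>, the map
  \<open>\<zeta> \<mapsto> sin (\<zeta> - \<omega>) / sin (\<zeta> + cnj \<omega>)\<close> is a conformal map of the strip onto the disk with zero
  \<open>\<omega>\<close>; it is the composition of \<open>\<zeta> \<mapsto> exp (2 \<i> \<zeta>)\<close>, onto the upper half-plane, with a Cayley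
  transform. Its numerator and denominator have arguments with equal imaginary parts.
\<close>

lemma Schwarz_Pick_strip:
  assumes "f holomorphic_on ball 0 1"
    and strip: "\<And>z. cmod z < 1 \<Longrightarrow> 0 < Re (f z) \<and> Re (f z) < pi / 2"
    and z: "cmod z < 1"
  shows "sin (Re (f z) - Re (f 0)) \<le> cmod z * sin (Re (f z) + Re (f 0))"
proof -
  define N where "N = (\<lambda>z. sin (f z - f 0))"
  define D where "D = (\<lambda>z. sin (f z + cnj (f 0)))"
  have ND: "cmod (N z) < cmod (D z)" if "cmod z < 1" for z
  proof -
    have "(sin (x + y))\<^sup>2 - (sin (x - y))\<^sup>2 = sin (2 * x) * sin (2 * y)" for x y :: real
      unfolding sin_add sin_diff sin_double by (simp add: power2_eq_square algebra_simps)
    then have "(cmod (D z))\<^sup>2 - (cmod (N z))\<^sup>2 = sin (2 * Re (f z)) * sin (2 * Re (f 0))"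
      unfolding N_def D_def by (subst cmod_sin_squared_diff) auto
    also have "\<dots> > 0"
      using strip[OF that] strip[of 0] by (intro mult_pos_pos sin_gt_zero) auto
    finally show ?thesis
      by (intro power2_less_imp_less[of _ "cmod (D z)"]) auto
  qed
  have "cmod (N z / D z) \<le> cmod z"
  proof (rule Schwarz_Lemma(1)[where f = "\<lambda>z. N z / D z"])
    have "D z \<noteq> 0" if "cmod z < 1" for z
      using ND[OF that] by auto
    then show "(\<lambda>z. N z / D z) holomorphic_on ball 0 1"
      using assms(1) unfolding N_def D_def by (auto intro!: holomorphic_intros)
    show "cmod (N z / D z) < 1" if "cmod z < 1" for z
      using ND[OF that] by (auto simp: norm_divide divide_simps)
  qed (use z in \<open>auto simp: N_def\<close>)
  then have "cmod (N z) \<le> cmod z * cmod (D z)"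
    using ND[OF z] by (simp add: norm_divide pos_divide_le_eq[OF le_less_trans[OF norm_ge_zero]])
  then have le: "(cmod (N z))\<^sup>2 \<le> (cmod z)\<^sup>2 * (cmod (D z))\<^sup>2"
    by (metis norm_ge_zero power_mono power_mult_distrib)
  \<comment> \<open>Both squared moduli exceed the squared sines of the real parts by the same \<open>E \<ge> 0\<close>, and since
    \<open>cmod z \<le> 1\<close>, removing \<open>E\<close> on both sides preserves the inequality.\<close>
  define E where "E = (cmod (N z))\<^sup>2 - (sin (Re (f z) - Re (f 0)))\<^sup>2"
  have N: "(cmod (N z))\<^sup>2 = (sin (Re (f z) - Re (f 0)))\<^sup>2 + E"
    by (simp add: E_def)
  have D: "(cmod (D z))\<^sup>2 = (sin (Re (f z) + Re (f 0)))\<^sup>2 + E"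
    using cmod_sin_squared_diff[of "f z - f 0" "f z + cnj (f 0)"] by (simp add: N_def D_def E_def)
  have "E \<ge> 0"
    using sin_squared_le_cmod_sin_squared[of "f z - f 0"] by (simp add: E_def N_def)
  then have "(cmod z)\<^sup>2 * E \<le> E"
    using z by (simp add: mult_left_le_one_le power_le_one)
  then have "(sin (Re (f z) - Re (f 0)))\<^sup>2 \<le> (cmod z * sin (Re (f z) + Re (f 0)))\<^sup>2"
    using le unfolding N D by (simp add: power_mult_distrib algebra_simps)
  moreover have "0 \<le> cmod z * sin (Re (f z) + Re (f 0))"
    using strip[OF z] strip[of 0] by (intro mult_nonneg_nonneg sin_ge_zero) auto
  ultimately show ?thesis
    by (rule power2_le_imp_le)
qed

section \<open>The bound for harmonic functions\<close>

text \<open>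
  Expanding the sines and dividing by \<open>cos x * cos y\<close> turns the hypothesis into
  \<open>tan x - tan y \<le> r * (tan x + tan y)\<close>. This is the description, in the tangent coordinate, of an
  interval of pseudo-hyperbolic radius \<open>r\<close> about \<open>y\<close> on a horizontal line of the strip.
\<close>

lemma tan_le_of_sin_diff_le:
  fixes x y r :: real
  assumes "0 < x" "x < pi / 2" "0 < y" "y < pi / 2" "r < 1"
    and le: "sin (x - y) \<le> r * sin (x + y)"
  shows "tan x \<le> tan y * ((1 + r) / (1 - r))"
proof -
  have cos: "cos x > 0" "cos y > 0"
    using assms by (auto intro!: cos_gt_zero)
  have "sin x * cos y * (1 - r) \<le> sin y * cos x * (1 + r)"
    using le by (simp add: sin_add sin_diff algebra_simps)
  then show ?thesis
    using cos \<open>r < 1\<close> by (simp add: tan_def field_simps)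
qed

lemma X_plus_mono:
  assumes "-1 < s" "s \<le> t" "t < 1" "0 \<le> r" "r < 1"
  shows "X_plus r s \<le> X_plus r t"
proof -
  have "tan (pi / 4 * (s + 1)) \<le> tan (pi / 4 * (t + 1))"
  proof (rule tan_mono_le)
    have "pi / 4 * (t + 1) < pi / 4 * 2" "0 < pi / 4 * (s + 1)"
      using assms by (auto intro!: mult_strict_left_mono)
    then show "- (pi / 2) < pi / 4 * (s + 1)" "pi / 4 * (t + 1) < pi / 2"
      using pi_gt_zero by linarith+
    show "pi / 4 * (s + 1) \<le> pi / 4 * (t + 1)"
      using assms by (intro mult_left_mono) auto
  qed
  then show ?thesis
    unfolding X_plus_def using assms
    by (intro diff_right_mono mult_left_mono arctan_monotone' mult_right_mono) auto
qed

text \<open>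
  The affine map \<open>w \<mapsto> pi / 4 * (w + 1)\<close> carries the strip \<open>-1 < Re w < 1\<close> to the strip of lemma
  \<open>Schwarz_Pick_strip\<close>, which is where the normalization in \<open>X_plus\<close> comes from.
\<close>

lemma real_harmonic_le_X_plus:
  fixes u :: "complex \<Rightarrow> real"
  assumes "harmonic_on u (ball 0 1)"
    and bound: "\<And>z. cmod z < 1 \<Longrightarrow> \<bar>u z\<bar> < 1"
    and z: "cmod z < 1"
  shows "u z \<le> X_plus (cmod z) (u 0)"
proof -
  obtain F where F: "F holomorphic_on ball 0 1" "\<And>z. z \<in> ball 0 1 \<Longrightarrow> u z = Re (F z)"
    using harmonic_on_eq_Re_holomorphic[OF assms(1)] by auto
  define f where "f = (\<lambda>z. of_real (pi / 4) * (F z + 1))"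
  have Re_f: "Re (f z) = pi / 4 * (u z + 1)" if "cmod z < 1" for z
    using F(2)[of z] that by (simp add: f_def)
  have strip: "0 < Re (f z) \<and> Re (f z) < pi / 2" if "cmod z < 1" for z
  proof -
    have "0 < pi / 4 * (u z + 1)" "pi / 4 * (u z + 1) < pi / 4 * 2"
      using bound[OF that] by (auto intro!: mult_strict_left_mono)
    then show ?thesis by (simp add: Re_f[OF that])
  qed
  have "sin (Re (f z) - Re (f 0)) \<le> cmod z * sin (Re (f z) + Re (f 0))"
    by (rule Schwarz_Pick_strip) (use F z strip in \<open>auto simp: f_def intro!: holomorphic_intros\<close>)
  then have "tan (Re (f z)) \<le> tan (Re (f 0)) * ((1 + cmod z) / (1 - cmod z))"
    using strip[of z] strip[of 0] z by (intro tan_le_of_sin_diff_le) auto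
  then have "arctan (tan (Re (f z))) \<le> arctan (tan (Re (f 0)) * ((1 + cmod z) / (1 - cmod z)))"
    by (rule arctan_monotone')
  moreover have "arctan (tan (Re (f z))) = Re (f z)"
    using strip[OF z] pi_gt_zero by (intro arctan_tan) linarith+
  ultimately have
    "pi / 4 * (u z + 1) \<le> arctan (tan (pi / 4 * (u 0 + 1)) * ((1 + cmod z) / (1 - cmod z)))"
    using z by (simp only: Re_f norm_zero zero_less_one)
  then show ?thesis
    by (simp add: X_plus_def field_simps)
qed

theorem theorem6:
  fixes h :: "complex \<Rightarrow> complex" and a :: complex
  assumes "a \<in> ball 0 1"
    and "harmonic_on h (ball 0 1)"
    and "h ` ball 0 1 \<subseteq> ball 0 1"
    and "h 0 = a"
  shows "\<forall>z\<in>ball 0 1. cmod (h z) \<le> X_plus (cmod z) (cmod a)"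
proof
  fix z :: complex assume "z \<in> ball 0 1"
  then have z: "cmod z < 1" by simp
  \<comment> \<open>If \<open>h z = 0\<close> then \<open>sgn (h z) = 0\<close>, and the argument still goes through with \<open>c = 0\<close>.\<close>
  define c where "c = cnj (sgn (h z))"
  have c: "cmod c \<le> 1" by (simp add: c_def norm_sgn)
  define u where "u = (\<lambda>w. Re (c * h w))"
  have u_le: "\<bar>u w\<bar> \<le> cmod (h w)" for w
    using abs_Re_le_cmod[of "c * h w"] mult_left_le_one_le[OF _ _ c, of "cmod (h w)"]
    by (simp add: u_def norm_mult)
  have h_less: "cmod (h w) < 1" if "cmod w < 1" for w
    using assms(3) that by (auto simp: image_subset_iff)
  have u_less: "\<bar>u w\<bar> < 1" if "cmod w < 1" for w
    using u_le[of w] h_less[OF that] by linarith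
  have "bounded_linear (\<lambda>w. Re (c * w))"
    by (intro bounded_linear_compose[OF bounded_linear_Re] bounded_linear_mult_right)
  then have u: "harmonic_on u (ball 0 1)"
    unfolding u_def using assms(2) by (rule harmonic_on_bounded_linear)
  have "c * h z = of_real (cmod (h z))"
    by (simp add: c_def sgn_eq complex_norm_square power2_eq_square field_simps
        flip: complex_norm_square)
  then have "cmod (h z) = u z"
    unfolding u_def by (metis Re_complex_of_real)
  also have "\<dots> \<le> X_plus (cmod z) (u 0)"
    using u u_less z by (rule real_harmonic_le_X_plus)
  also have "\<dots> \<le> X_plus (cmod z) (cmod a)"
    using u_le[of 0] u_less[of 0] assms(1,4) z by (intro X_plus_mono) auto
  finally show "cmod (h z) \<le> X_plus (cmod z) (cmod a)" .
qed

end
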